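(* Let $M>0$, $D\ge0$, $\bar P>0$ and $\bar\delta\in(0,\pi/2)$, and consider the system $$M\ddot{\tilde\delta}+D\dot{\tilde\delta}=\bar P\sin\bar\delta-\bar P\sin(\tilde\delta+\bar\delta)$$ with state $x_1=(\dot{\tilde\delta},\tilde\delta)\in\mathbb{R}^2$. Let $$W(x_1)=\frac M2\dot{\tilde\delta}^2-\bar P\,\tilde\delta\sin\bar\delta+\bar P\cos\bar\delta-\bar P\cos(\tilde\delta+\bar\delta),$$ and let $c$ satisfy $$0<c<\bar P\big(2\cos\bar\delta-(\pi-2\bar\delta)\sin\bar\delta\big).$$ Then the set $$\Omega=\{x_1=(\dot{\tilde\delta},\tilde\delta)\in\mathbb{R}^2 : W(x_1)\le c\ \text{ and }\ |\tilde\delta|\le\pi-2\bar\delta\}$$ is a compact invariant set of the system.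
   Context: This is the swing equation of a single-machine-infinite-bus power system: $\tilde\delta$ is the deviation of the voltage phase angle from its steady-state value $\bar\delta$, $M$ the inertia, $D$ the damping coefficient and $\bar P$ (denoted $\bar P^E_{\max}$ in power-systems notation) the maximum power transfer. "Invariant" means that every trajectory starting in the set at time $0$ remains in the set for all $t\ge0$. *)

theory Defs
  imports "HOL-Analysis.Analysis"
begin

text \<open>
  States are pairs \<open>(\<omega>, \<delta>)\<close> of the frequency \<open>\<omega> = \<delta>'\<close> and the phase-angle deviation \<open>\<delta>\<close>;
  \<open>\<delta>b\<close> is the steady-state angle. Derivatives are taken within the time set \<open>J\<close>, hence they are
  one-sided at end points of \<open>J\<close>.
\<close>

definition swing_trajectory ::
    "real \<Rightarrow> real \<Rightarrow> real \<Rightarrow> real \<Rightarrow> real set \<Rightarrow> (real \<Rightarrow> real \<times> real) \<Rightarrow> bool" where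
  "swing_trajectory M D P \<delta>b J x \<longleftrightarrow>
     (\<forall>t\<in>J.
        ((\<lambda>s. snd (x s)) has_real_derivative fst (x t)) (at t within J) \<and>
        (\<exists>a. ((\<lambda>s. fst (x s)) has_real_derivative a) (at t within J) \<and>
             M * a + D * fst (x t) = P * sin \<delta>b - P * sin (snd (x t) + \<delta>b)))"

text \<open>
  The time set \<open>J\<close> may be \<open>[0, \<infinity>)\<close>, but trajectories that are only given on a
  bounded interval starting at time \<open>0\<close> are covered as well, so that the notion does not
  become vacuous where solutions fail to exist globally.
\<close>

definition invariant_set :: "(real set \<Rightarrow> (real \<Rightarrow> 'a) \<Rightarrow> bool) \<Rightarrow> 'a set \<Rightarrow> bool" where
  "invariant_set traj S \<longleftrightarrow>
     (\<forall>J x. is_interval J \<and> 0 \<in> J \<and> J \<subseteq> {0..} \<and> traj J x \<and> x 0 \<in> S \<longrightarrow> (\<forall>t\<in>J. x t \<in> S))"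

definition swing_energy :: "real \<Rightarrow> real \<Rightarrow> real \<Rightarrow> real \<times> real \<Rightarrow> real" where
  "swing_energy M P \<delta>b = (\<lambda>(\<omega>, \<delta>).
     M / 2 * \<omega>\<^sup>2 - P * \<delta> * sin \<delta>b + P * cos \<delta>b - P * cos (\<delta> + \<delta>b))"

end

theory Submission imports Defs begin

text \<open>
  The energy is nonincreasing along every trajectory, since its derivative is \<open>- D \<omega>\<^sup>2\<close>. On both
  boundary lines \<open>\<bar>\<delta>\<bar> = \<pi> - 2 \<delta>b\<close> it exceeds the level \<open>c\<close>, so by continuity a trajectory can
  never cross them.
\<close>

lemma swing_energy_le_kinetic:
  assumes "M \<ge> 0"
  shows "swing_energy M P \<delta>b (0, \<delta>) \<le> swing_energy M P \<delta>b (\<omega>, \<delta>)"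
  using assms by (simp add: swing_energy_def)

text \<open>The sine agrees at \<open>pi - \<delta>b\<close> and \<open>\<delta>b\<close>, so this
  boundary point is itself an equilibrium. Its energy is exactly the strict upper bound that the
  theorem puts on \<open>c\<close>.\<close>

lemma swing_energy_at_right_boundary:
  "swing_energy M P \<delta>b (0, pi - 2 * \<delta>b) = P * (2 * cos \<delta>b - (pi - 2 * \<delta>b) * sin \<delta>b)"
proof -
  have "cos (pi - 2 * \<delta>b + \<delta>b) = - cos \<delta>b"
    using cos_pi_minus[of \<delta>b] by simp
  then show ?thesis
    by (simp add: swing_energy_def algebra_simps)
qed

text \<open>With \<open>y = pi - 2 * \<delta>b \<ge> 0\<close>, the two energies differ by
  \<open>2 * P * sin \<delta>b * (y - sin y)\<close>, so everything reduces to
  \<open>sin y \<le> y\<close>. Hence a level below the right boundary value lies below the left one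
  too.\<close>

lemma swing_energy_boundary_left_ge_right:
  assumes "P \<ge> 0" and "0 \<le> \<delta>b" and "\<delta>b \<le> pi / 2"
  shows "swing_energy M P \<delta>b (0, pi - 2 * \<delta>b) \<le> swing_energy M P \<delta>b (0, - (pi - 2 * \<delta>b))"
proof -
  have "cos (- (pi - 2 * \<delta>b) + \<delta>b) = cos (pi - 3 * \<delta>b)"
    using cos_minus[of "pi - 3 * \<delta>b"] by (simp add: algebra_simps)
  then have left: "cos (- (pi - 2 * \<delta>b) + \<delta>b) = - cos (3 * \<delta>b)"
    by simp
  \<comment> \<open>Subtracting the formulas for \<open>2 * \<delta>b + \<delta>b\<close> and
    \<open>2 * \<delta>b - \<delta>b\<close> eliminates the product of cosines and leaves the factor
    \<open>sin (2 * \<delta>b)\<close> that \<open>diff\<close> needs.\<close>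
  have "cos (3 * \<delta>b) = cos (2 * \<delta>b) * cos \<delta>b - sin (2 * \<delta>b) * sin \<delta>b"
    and "cos \<delta>b = cos (2 * \<delta>b) * cos \<delta>b + sin (2 * \<delta>b) * sin \<delta>b"
    using cos_add[of "2 * \<delta>b" \<delta>b] cos_diff[of "2 * \<delta>b" \<delta>b] by simp_all
  then have cos3: "cos (3 * \<delta>b) = cos \<delta>b - 2 * sin (2 * \<delta>b) * sin \<delta>b"
    by linarith
  have diff: "swing_energy M P \<delta>b (0, - (pi - 2 * \<delta>b)) - swing_energy M P \<delta>b (0, pi - 2 * \<delta>b)
      = 2 * P * sin \<delta>b * (pi - 2 * \<delta>b - sin (2 * \<delta>b))"
    unfolding swing_energy_at_right_boundary unfolding swing_energy_def split left cos3
    by (simp add: algebra_simps)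
  \<comment> \<open>Here \<open>sin (2 * \<delta>b)\<close> equals
    \<open>sin (pi - 2 * \<delta>b)\<close>.\<close>
  have "sin (2 * \<delta>b) \<le> pi - 2 * \<delta>b"
    using sin_x_le_x[of "pi - 2 * \<delta>b"] assms by simp
  moreover have "sin \<delta>b \<ge> 0"
    using assms by (intro sin_ge_zero) auto
  ultimately have "0 \<le> 2 * P * sin \<delta>b * (pi - 2 * \<delta>b - sin (2 * \<delta>b))"
    using assms by simp
  with diff show ?thesis by linarith
qed

text \<open>The chain rule gives \<open>x1 t\<close> times a bracket that the equation of motion
  turns into \<open>- D * x1 t\<close>: inertial and potential terms cancel and only damping
  remains.\<close>

lemma swing_energy_has_derivative:
  assumes "(x1 has_real_derivative a) (at t within J)"
    and "(x2 has_real_derivative x1 t) (at t within J)"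
    and "M * a + D * x1 t = P * sin \<delta>b - P * sin (x2 t + \<delta>b)"
  shows "((\<lambda>s. swing_energy M P \<delta>b (x1 s, x2 s)) has_real_derivative - D * (x1 t)\<^sup>2) (at t within J)"
proof -
  have "((\<lambda>s. swing_energy M P \<delta>b (x1 s, x2 s)) has_real_derivative
      x1 t * (M * a - P * sin \<delta>b + P * sin (x2 t + \<delta>b))) (at t within J)"
    unfolding swing_energy_def split
    by (auto intro!: derivative_eq_intros assms(1,2) simp: algebra_simps)
  moreover have "M * a - P * sin \<delta>b + P * sin (x2 t + \<delta>b) = - D * x1 t"
    using assms(3) by simp
  ultimately show ?thesis
    by (simp add: power2_eq_square mult.left_commute)
qed

lemma swing_energy_nonincreasing:
  assumes traj: "swing_trajectory M D P \<delta>b J x" and "D \<ge> 0"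
    and "{s..t} \<subseteq> J" and "s \<le> t"
  shows "swing_energy M P \<delta>b (x t) \<le> swing_energy M P \<delta>b (x s)"
proof -
  have deriv: "((\<lambda>r. swing_energy M P \<delta>b (x r)) has_real_derivative - D * (fst (x r))\<^sup>2)
      (at r within {s..t})" if r: "r \<in> {s..t}" for r
  proof -
    obtain a where "((\<lambda>r. fst (x r)) has_real_derivative a) (at r within J)"
      and "((\<lambda>r. snd (x r)) has_real_derivative fst (x r)) (at r within J)"
      and "M * a + D * fst (x r) = P * sin \<delta>b - P * sin (snd (x r) + \<delta>b)"
      using traj r \<open>{s..t} \<subseteq> J\<close> unfolding swing_trajectory_def by blast
    from swing_energy_has_derivative[OF this] show ?thesis
      using DERIV_subset[OF _ \<open>{s..t} \<subseteq> J\<close>] by simp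
  qed
  show ?thesis
  \<comment> \<open>Derivatives may be one-sided at \<open>s\<close> and \<open>t\<close>, so the
    criterion chosen asks for two-sided ones only in the open interval, plus continuity on the
    closed one.\<close>
  proof (rule DERIV_nonpos_imp_decreasing_open[OF \<open>s \<le> t\<close>])
    fix r assume r: "s < r" "r < t"
    then have "((\<lambda>r. swing_energy M P \<delta>b (x r)) has_real_derivative - D * (fst (x r))\<^sup>2) (at r)"
      using deriv[of r] by (simp add: at_within_Icc_at)
    moreover have "- D * (fst (x r))\<^sup>2 \<le> 0"
      using \<open>D \<ge> 0\<close> by simp
    ultimately show "\<exists>y. ((\<lambda>r. swing_energy M P \<delta>b (x r)) has_real_derivative y) (at r) \<and> y \<le> 0"
      by blast
  next
    show "continuous_on {s..t} (\<lambda>r. swing_energy M P \<delta>b (x r))"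
      using deriv by (rule DERIV_continuous_on)
  qed
qed

text \<open>On the strip the potential part of the energy is bounded, so a bound on the energy
  bounds the kinetic term and, as \<open>M > 0\<close>, the frequency. The set is thus a closed
  subset of a rectangle.\<close>

lemma compact_swing_energy_sublevel:
  assumes "M > 0"
  shows "compact {(\<omega>, \<delta>). swing_energy M P \<delta>b (\<omega>, \<delta>) \<le> c \<and> \<bar>\<delta>\<bar> \<le> L}" (is "compact ?S")
proof -
  \<comment> \<open>\<open>K\<close> results from solving \<open>M / 2 * \<omega>\<^sup>2 \<le> c +
    (\<bar>P\<bar> * L + 2 * \<bar>P\<bar>)\<close> for the square; the bracket bounds the three
    potential terms.\<close>
  define K where "K = 2 / M * (c + (\<bar>P\<bar> * L + 2 * \<bar>P\<bar>))"
  have "closed {z. swing_energy M P \<delta>b z \<le> c}"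
    unfolding swing_energy_def split_def
    by (intro closed_Collect_le continuous_intros)
  moreover have "closed {z::real \<times> real. \<bar>snd z\<bar> \<le> L}"
    by (intro closed_Collect_le continuous_intros)
  moreover have "?S = {z. swing_energy M P \<delta>b z \<le> c} \<inter> {z. \<bar>snd z\<bar> \<le> L}"
    by auto
  ultimately have closed: "closed ?S"
    by (simp add: closed_Int)
  have sub: "?S \<subseteq> {- sqrt K..sqrt K} \<times> {- L..L}"
  proof safe
    fix \<omega> \<delta> assume W: "swing_energy M P \<delta>b (\<omega>, \<delta>) \<le> c" and \<delta>: "\<bar>\<delta>\<bar> \<le> L"
    have "\<bar>P * \<delta> * sin \<delta>b\<bar> \<le> \<bar>P\<bar> * L * 1"
      unfolding abs_mult using \<delta> by (intro mult_mono) auto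
    moreover have "\<bar>P * cos \<delta>b\<bar> \<le> \<bar>P\<bar>" and "\<bar>P * cos (\<delta> + \<delta>b)\<bar> \<le> \<bar>P\<bar>"
      unfolding abs_mult by (simp_all add: mult_left_le)
    ultimately have "M / 2 * \<omega>\<^sup>2 \<le> c + (\<bar>P\<bar> * L + 2 * \<bar>P\<bar>)"
      using W unfolding swing_energy_def split by linarith
    then have "\<omega>\<^sup>2 \<le> K"
      using \<open>M > 0\<close> unfolding K_def by (simp add: field_simps)
    then have "\<bar>\<omega>\<bar> \<le> sqrt K"
      using real_le_rsqrt by simp
    then show "\<omega> \<in> {- sqrt K..sqrt K}"
      by auto
    show "\<delta> \<in> {- L..L}"
      using \<delta> by auto
  qed
  have "compact ({- sqrt K..sqrt K} \<times> {- L..L})"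
    by (intro compact_Times compact_Icc)
  then have "compact (({- sqrt K..sqrt K} \<times> {- L..L}) \<inter> ?S)"
    using closed by (rule compact_Int_closed)
  then show ?thesis
    unfolding Int_absorb1[OF sub] .
qed

theorem mainTheorem5:
  fixes M D P \<delta>b c :: real
    and \<Omega> :: "(real \<times> real) set"
  assumes "M > 0" and "D \<ge> 0" and "P > 0"
    and "0 < \<delta>b" and "\<delta>b < pi / 2"
    and "0 < c" and "c < P * (2 * cos \<delta>b - (pi - 2 * \<delta>b) * sin \<delta>b)"
  defines "\<Omega> \<equiv> {(\<omega>, \<delta>). swing_energy M P \<delta>b (\<omega>, \<delta>) \<le> c \<and> \<bar>\<delta>\<bar> \<le> pi - 2 * \<delta>b}"
  shows "compact \<Omega> \<and> invariant_set (swing_trajectory M D P \<delta>b) \<Omega>"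
proof
  show "compact \<Omega>"
    unfolding \<Omega>_def using \<open>M > 0\<close> by (rule compact_swing_energy_sublevel)
  \<comment> \<open>The kinetic term only raises the energy, so it suffices to compare
    \<open>c\<close> with the two boundary points of zero frequency. The inequality is strict, which
    the final contradiction requires.\<close>
  have barrier: "c < swing_energy M P \<delta>b z" if "\<bar>snd z\<bar> = pi - 2 * \<delta>b" for z
  proof -
    have "c < swing_energy M P \<delta>b (0, pi - 2 * \<delta>b)"
      using assms by (simp add: swing_energy_at_right_boundary)
    moreover from this have "c < swing_energy M P \<delta>b (0, - (pi - 2 * \<delta>b))"
      using swing_energy_boundary_left_ge_right[of P \<delta>b M] assms by linarith
    moreover have "snd z = pi - 2 * \<delta>b \<or> snd z = - (pi - 2 * \<delta>b)"
      using that by linarith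
    ultimately have "c < swing_energy M P \<delta>b (0, snd z)"
      by metis
    also have "\<dots> \<le> swing_energy M P \<delta>b z"
      using swing_energy_le_kinetic[of M P \<delta>b "snd z" "fst z"] \<open>M > 0\<close> by simp
    finally show ?thesis .
  qed
  show "invariant_set (swing_trajectory M D P \<delta>b) \<Omega>"
    unfolding invariant_set_def
  proof (intro allI impI ballI, elim conjE)
    fix J x t
    assume J: "is_interval J" "0 \<in> J" "J \<subseteq> {0..}" and traj: "swing_trajectory M D P \<delta>b J x"
      and init: "x 0 \<in> \<Omega>" and t: "t \<in> J"
    have "t \<ge> 0"
      using J t by auto
    have sub: "{0..s} \<subseteq> J" if "s \<in> J" for s
      using mem_is_interval_1_I[OF J(1,2) that] by auto
    \<comment> \<open>This bound uses only the energy at time \<open>0\<close>, not that the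
      trajectory has stayed in the strip, so the crossing argument below is not circular.\<close>
    have energy: "swing_energy M P \<delta>b (x s) \<le> c" if "s \<in> {0..t}" for s
    proof -
      have "{0..s} \<subseteq> J"
        using sub[OF t] that by auto
      then have "swing_energy M P \<delta>b (x s) \<le> swing_energy M P \<delta>b (x 0)"
        using swing_energy_nonincreasing[OF traj \<open>D \<ge> 0\<close>] that by simp
      also have "\<dots> \<le> c"
        using init unfolding \<Omega>_def by auto
      finally show ?thesis .
    qed
    have "continuous_on J (\<lambda>s. snd (x s))"
      by (rule DERIV_continuous_on[where D = "\<lambda>s. fst (x s)"])
        (use traj in \<open>auto simp: swing_trajectory_def\<close>)
    then have cont: "continuous_on {0..t} (\<lambda>s. \<bar>snd (x s)\<bar>)"
      by (intro continuous_on_rabs) (rule continuous_on_subset[OF _ sub[OF t]])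
    have "\<bar>snd (x t)\<bar> \<le> pi - 2 * \<delta>b"
    \<comment> \<open>If the angle left the strip, the intermediate value theorem would give an
      earlier or equal time on a boundary line, where \<open>energy\<close> and
      \<open>barrier\<close> contradict each other.\<close>
    proof (rule ccontr)
      assume "\<not> ?thesis"
      then have "pi - 2 * \<delta>b \<le> \<bar>snd (x t)\<bar>" by simp
      moreover have "\<bar>snd (x 0)\<bar> \<le> pi - 2 * \<delta>b"
        using init unfolding \<Omega>_def by auto
      ultimately obtain s where "0 \<le> s" "s \<le> t" "\<bar>snd (x s)\<bar> = pi - 2 * \<delta>b"
        using IVT'[of "\<lambda>s. \<bar>snd (x s)\<bar>" 0 "pi - 2 * \<delta>b" t] cont \<open>t \<ge> 0\<close> by blast
      with energy[of s] barrier[of "x s"] show False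
        by simp
    qed
    with energy[of t] \<open>t \<ge> 0\<close> show "x t \<in> \<Omega>"
      unfolding \<Omega>_def by (auto simp: case_prod_unfold)
  qed
qed

end
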